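(* Suppose $0<\alpha\le 1$, $m\ge 0$ and $q_1<q<q_2$, where $$q_1=-n+\sqrt{n^2+\alpha m^2},\qquad q_2=\left(1-\frac{1}{(\alpha+1)^{1/2}}\right)\left(n+\left((\alpha+1)^{1/2}-1\right)m\right).$$ If $m>0$, then the variational problem $(P_0)$ has a global minimizer, and every global minimizer takes (almost everywhere) the form $$\mathbf u=\mathbf a\,\chi_U+\mathbf b\,\chi_{\Omega\setminus U}$$ for a measurable set $U\subset\Omega$, where $$\mathbf a=\left(\sqrt{\frac{A+B}{2}},\,0,\,\sqrt{\frac{A-B}{2}}\right),\qquad \mathbf b=\left(0,\sqrt[4]{A^2+\alpha B^2},0\right),$$ $$A=n+(r-1)q,\qquad B=\frac{m}{r},$$ and $r:=|U|/|\Omega|$ satisfies $$2q^2r^3+(2qn-q^2)r^2-\alpha m^2=0.$$ If $m=0$, then the global minimizer of $(P_0)$ is (almost everywhere) $\mathbf u=\mathbf b\,\chi_\Omega$ with $\mathbf b=(0,\sqrt n,0)$.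
   Context: $\Omega\subset\mathbb R^3$ is a bounded domain with smooth boundary, $|\cdot|$ denotes Lebesgue measure, $\chi_S$ is the characteristic function of a set $S$, and $\mathbb R_+=[0,\infty)$. Real numbers $\alpha$, $q$, $N>0$, $M$ are given with $0\le M\le N$; put $n=N/|\Omega|$ and $m=M/|\Omega|$. A vector is written $\mathbf u=(u_1,u_0,u_{-1})\in\mathbb R_+^3$. The Thomas-Fermi Hamiltonian is $$H_{TF}(\mathbf u)=\tfrac12(u_1^2+u_0^2+u_{-1}^2)^2+\tfrac{\alpha}{2}\left[2u_0^2(u_1-\mathrm{sgn}(\alpha)u_{-1})^2+(u_1^2-u_{-1}^2)^2\right]+q(u_1^2+u_{-1}^2).$$ Problem $(P_0)$: minimize $\int_\Omega H_{TF}(\mathbf u(x))\,dx$ over all $\mathbf u\in (L^2(\Omega,\mathbb R_+))^3$ subject to $\int_\Omega (u_1^2+u_0^2+u_{-1}^2)\,dx=N$ and $\int_\Omega (u_1^2-u_{-1}^2)\,dx=M$. *)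

theory Defs
  imports "HOL-Analysis.Analysis"
begin

primrec Ck_on :: "nat \<Rightarrow> ('a::euclidean_space \<Rightarrow> real) \<Rightarrow> 'a set \<Rightarrow> bool" where
  "Ck_on 0 f V \<longleftrightarrow> continuous_on V f"
| "Ck_on (Suc k) f V \<longleftrightarrow>
     f differentiable_on V \<and> (\<forall>i\<in>Basis. Ck_on k (\<lambda>x. frechet_derivative f (at x) i) V)"

text \<open>Only used for open sets, where \<^term>\<open>f differentiable_on V\<close> is
  differentiability at every point and the derivatives above are the partial derivatives.\<close>

definition smooth_on :: "('a::euclidean_space \<Rightarrow> real) \<Rightarrow> 'a set \<Rightarrow> bool" where
  "smooth_on f V \<longleftrightarrow> (\<forall>k. Ck_on k f V)"

text \<open>Smoothness of the boundary is expressed by local defining functions: near each boundary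
  point the set is a strict sublevel set of a smooth function without critical points. By the
  implicit function theorem this says that the set lies locally on one side of the graph of
  a smooth function.\<close>

definition smooth_boundary :: "'a::euclidean_space set \<Rightarrow> bool" where
  "smooth_boundary \<Omega> \<longleftrightarrow> (\<forall>p\<in>frontier \<Omega>. \<exists>V \<rho>. open V \<and> p \<in> V \<and> smooth_on \<rho> V \<and> \<rho> p = 0 \<and>
     (\<forall>x\<in>V. frechet_derivative \<rho> (at x) \<noteq> (\<lambda>_. 0)) \<and> \<Omega> \<inter> V = {x\<in>V. \<rho> x < 0})"

definition bounded_smooth_domain :: "'a::euclidean_space set \<Rightarrow> bool" where
  "bounded_smooth_domain \<Omega> \<longleftrightarrow>
     open \<Omega> \<and> connected \<Omega> \<and> \<Omega> \<noteq> {} \<and> bounded \<Omega> \<and> smooth_boundary \<Omega>"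

text \<open>A vector of densities is a triple \<^term>\<open>(u1, u0, um)\<close>, where \<^term>\<open>um\<close> is the
  component with index $-1$.\<close>

definition H_TF :: "real \<Rightarrow> real \<Rightarrow> real \<times> real \<times> real \<Rightarrow> real" where
  "H_TF \<alpha> q = (\<lambda>(u1, u0, um).
     1/2 * (u1\<^sup>2 + u0\<^sup>2 + um\<^sup>2)\<^sup>2
     + \<alpha>/2 * (2 * u0\<^sup>2 * (u1 - sgn \<alpha> * um)\<^sup>2 + (u1\<^sup>2 - um\<^sup>2)\<^sup>2)
     + q * (u1\<^sup>2 + um\<^sup>2))"

text \<open>Elements of the L2 space are represented by functions on the whole space, of which only the
  restriction to \<^term>\<open>\<Omega>\<close> matters, and nonnegativity is required almost everywhere.\<close>

definition L2_nonneg :: "'a::euclidean_space set \<Rightarrow> ('a \<Rightarrow> real) set" where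
  "L2_nonneg \<Omega> = {f. f \<in> borel_measurable (lebesgue_on \<Omega>) \<and>
     integrable (lebesgue_on \<Omega>) (\<lambda>x. (f x)\<^sup>2) \<and> (AE x in lebesgue_on \<Omega>. 0 \<le> f x)}"

definition admissible ::
    "'a::euclidean_space set \<Rightarrow> real \<Rightarrow> real \<Rightarrow> ('a \<Rightarrow> real \<times> real \<times> real) set" where
  "admissible \<Omega> N M = {u. \<exists>u1 u0 um. u = (\<lambda>x. (u1 x, u0 x, um x)) \<and>
     u1 \<in> L2_nonneg \<Omega> \<and> u0 \<in> L2_nonneg \<Omega> \<and> um \<in> L2_nonneg \<Omega> \<and>
     (\<integral>x. (u1 x)\<^sup>2 + (u0 x)\<^sup>2 + (um x)\<^sup>2 \<partial>lebesgue_on \<Omega>) = N \<and>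
     (\<integral>x. (u1 x)\<^sup>2 - (um x)\<^sup>2 \<partial>lebesgue_on \<Omega>) = M}"

text \<open>The Hamiltonian is quartic, so its integral over an L2 function may be infinite. The energy is
  therefore the extended integral (positive part minus negative part) instead of the
  Bochner integral, which would assign the value 0 to non-integrable functions. For
  \<^prop>\<open>\<alpha> \<ge> 0\<close> the negative part is finite on admissible functions.\<close>

definition TF_energy ::
    "real \<Rightarrow> real \<Rightarrow> 'a::euclidean_space set \<Rightarrow> ('a \<Rightarrow> real \<times> real \<times> real) \<Rightarrow> ereal" where
  "TF_energy \<alpha> q \<Omega> u =
     enn2ereal (\<integral>\<^sup>+x. ennreal (H_TF \<alpha> q (u x)) \<partial>lebesgue_on \<Omega>)
     - enn2ereal (\<integral>\<^sup>+x. ennreal (- H_TF \<alpha> q (u x)) \<partial>lebesgue_on \<Omega>)"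

definition P0_minimizer ::
    "real \<Rightarrow> real \<Rightarrow> real \<Rightarrow> real \<Rightarrow> 'a::euclidean_space set \<Rightarrow> ('a \<Rightarrow> real \<times> real \<times> real) \<Rightarrow> bool" where
  "P0_minimizer \<alpha> q N M \<Omega> u \<longleftrightarrow> is_arg_min (TF_energy \<alpha> q \<Omega>) (\<lambda>v. v \<in> admissible \<Omega> N M) u"

end

theory Submission
  imports Defs "HOL-Probability.Distribution_Functions"
begin

text \<open>Put \<open>\<nu> = A + q\<close>. Dividing the cubic by \<open>r\<^sup>2\<close> turns it into \<open>\<alpha> B\<^sup>2 = 2 A q + q\<^sup>2\<close>, that is,
  \<open>\<nu>\<^sup>2 = A\<^sup>2 + \<alpha> B\<^sup>2\<close>. With the Lagrange multipliers \<open>\<nu>\<close> for the mass and \<open>\<alpha> B\<close> for the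
  magnetization, the augmented Hamiltonian
  \<open>H - \<nu> (u\<^sub>1\<^sup>2 + u\<^sub>0\<^sup>2 + u\<^sub>-\<^sub>1\<^sup>2) - \<alpha> B (u\<^sub>1\<^sup>2 - u\<^sub>-\<^sub>1\<^sup>2) + \<nu>\<^sup>2 / 2\<close> is nonnegative on the positive octant and
  vanishes exactly at \<open>a\<close> and \<open>b\<close>. So an admissible function is a minimizer as soon as it takes only
  these two values, and then every minimizer does; the magnetization constraint fixes the volume
  fraction of the phase \<open>a\<close>. The bound \<open>q\<^sub>1 < q\<close> yields a root \<open>r\<close> in the open unit interval and
  \<open>q < q\<^sub>2\<close> yields \<open>B \<le> A\<close>.\<close>

section \<open>Sets of prescribed volume\<close>

text \<open>Since every level set of \<open>f\<close> is null, the distribution of \<open>f\<close>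
  on \<open>S\<close> has no atoms, so its distribution function is continuous and climbs from 0 to
  the measure of \<open>S\<close>; the intermediate value theorem gives the level.\<close>

lemma exists_sublevel_measure:
  fixes f :: "'a::euclidean_space \<Rightarrow> real"
  assumes S: "S \<in> lmeasurable" and f: "f \<in> borel_measurable borel"
    and null: "\<And>t. {x. f x = t} \<in> null_sets lebesgue"
    and c: "0 < c" "c < measure lebesgue S"
  obtains t where "measure lebesgue {x \<in> S. f x \<le> t} = c"
proof -
  have Ss: "S \<in> sets lebesgue" using S by blast
  have f': "f \<in> borel_measurable lebesgue" using f by (intro measurable_completion) simp
  have fS: "f \<in> borel_measurable (lebesgue_on S)"
    using f' by (rule measurable_restrict_space1)
  interpret L: finite_measure "lebesgue_on S"
    using S by (rule finite_measure_lebesgue_on)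
  define D where "D = distr (lebesgue_on S) borel f"
  have fin: "finite_measure D" unfolding D_def by (rule L.finite_measure_distr[OF fS])
  interpret D: finite_borel_measure D
    using fin by (simp add: finite_borel_measure_def finite_borel_measure_axioms_def D_def)
  have val: "measure D X = measure lebesgue {x \<in> S. f x \<in> X}" if "X \<in> sets borel" for X
  proof -
    have "measure D X = measure (lebesgue_on S) (f -` X \<inter> S)"
      using that fS by (simp add: D_def measure_distr)
    also have "\<dots> = measure lebesgue (f -` X \<inter> S)"
      by (rule measure_restrict_space) (use Ss in auto)
    also have "f -` X \<inter> S = {x \<in> S. f x \<in> X}" by auto
    finally show ?thesis .
  qed
  have cont: "isCont (cdf D) t" for t
  proof -
    have "{x \<in> S. f x \<in> {t}} \<in> null_sets lebesgue"
      by (rule null_sets_completion_subset[OF _ null[of t]]) auto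
    then have "measure D {t} = 0"
      by (subst val) (auto simp: measure_eq_0_null_sets)
    then show ?thesis by (simp add: D.isCont_cdf)
  qed
  have top: "((cdf D) \<longlongrightarrow> measure lebesgue S) at_top"
    using D.cdf_lim_at_top val[of UNIV] by (simp add: D_def)
  obtain b where b: "cdf D b > c"
    using order_tendstoD(1)[OF top c(2)] by (auto simp: eventually_at_top_linorder)
  obtain a where a: "cdf D a < c"
    using order_tendstoD(2)[OF D.cdf_lim_at_bot c(1)] by (auto simp: eventually_at_bot_linorder)
  have "a \<le> b" using a b D.cdf_nondecreasing[of b a] by linarith
  then obtain t where "cdf D t = c"
    using IVT[of "cdf D" a c b] a b cont by auto
  then have "measure lebesgue {x \<in> S. f x \<le> t} = c"
    by (simp add: cdf_def val)
  then show ?thesis by (rule that)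
qed

section \<open>Lagrange multipliers as a sufficient condition for minimality\<close>

lemma H_TF_nonneg:
  assumes "0 \<le> \<alpha>" "0 \<le> q"
  shows "0 \<le> H_TF \<alpha> q v"
  using assms by (cases v) (auto simp: H_TF_def intro!: add_nonneg_nonneg mult_nonneg_nonneg)

text \<open>\<open>G\<close> is affine in the two constrained densities, so its integral is the same
  number \<open>K\<close> for all admissible functions. As \<open>G\<close> lies below the
  Hamiltonian, \<open>K\<close> bounds every energy from below. It is attained at \<open>w\<close>,
  and any other function attaining it must have a vanishing gap almost everywhere.\<close>

lemma multiplier_minimizer:
  fixes \<Omega> :: "'a::euclidean_space set" and \<nu> \<mu> c :: real
  defines "G \<equiv> \<lambda>(u1, u0, um). \<nu> * (u1\<^sup>2 + u0\<^sup>2 + um\<^sup>2) + \<mu> * (u1\<^sup>2 - um\<^sup>2) - c"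
  assumes \<Omega>: "\<Omega> \<in> lmeasurable" and \<alpha>: "0 \<le> \<alpha>" and q: "0 \<le> q"
    and bound: "\<And>u1 u0 um. 0 \<le> u1 \<Longrightarrow> 0 \<le> u0 \<Longrightarrow> 0 \<le> um \<Longrightarrow>
       G (u1, u0, um) \<le> H_TF \<alpha> q (u1, u0, um)"
    and w: "w \<in> admissible \<Omega> N M" and weq: "AE x in lebesgue_on \<Omega>. H_TF \<alpha> q (w x) = G (w x)"
  shows "P0_minimizer \<alpha> q N M \<Omega> w"
    and "P0_minimizer \<alpha> q N M \<Omega> u \<Longrightarrow> AE x in lebesgue_on \<Omega>. H_TF \<alpha> q (u x) = G (u x)"
proof -
  let ?L = "lebesgue_on \<Omega>"
  define K where "K = \<nu> * N + \<mu> * M - c * measure lebesgue \<Omega>"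
  interpret L: finite_measure ?L
    using \<Omega> by (rule finite_measure_lebesgue_on)
  have nneg: "0 \<le> H_TF \<alpha> q v" for v using H_TF_nonneg[OF \<alpha> q] .
  \<comment> \<open>The Hamiltonian is nonnegative, so the subtracted negative part of the energy is
    zero.\<close>
  have en: "TF_energy \<alpha> q \<Omega> v = enn2ereal (\<integral>\<^sup>+x. ennreal (H_TF \<alpha> q (v x)) \<partial>?L)" for v
    using nneg by (simp add: TF_energy_def ennreal_neg zero_ennreal.rep_eq)
  have sp: "measure ?L \<Omega> = measure lebesgue \<Omega>"
    using \<Omega> by (subst measure_restrict_space) auto
  have adm: "integrable ?L (\<lambda>x. G (v x)) \<and> (\<integral>x. G (v x) \<partial>?L) = K
      \<and> (\<lambda>x. H_TF \<alpha> q (v x)) \<in> borel_measurable ?L \<and> (AE x in ?L. G (v x) \<le> H_TF \<alpha> q (v x))"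
    if "v \<in> admissible \<Omega> N M" for v
  proof -
    from that obtain u1 u0 um where v: "v = (\<lambda>x. (u1 x, u0 x, um x))"
      and L2: "u1 \<in> L2_nonneg \<Omega>" "u0 \<in> L2_nonneg \<Omega>" "um \<in> L2_nonneg \<Omega>"
      and N: "(\<integral>x. (u1 x)\<^sup>2 + (u0 x)\<^sup>2 + (um x)\<^sup>2 \<partial>?L) = N"
      and M: "(\<integral>x. (u1 x)\<^sup>2 - (um x)\<^sup>2 \<partial>?L) = M"
      by (auto simp: admissible_def)
    from L2 have [measurable]: "u1 \<in> borel_measurable ?L" "u0 \<in> borel_measurable ?L"
        "um \<in> borel_measurable ?L"
      and i: "integrable ?L (\<lambda>x. (u1 x)\<^sup>2)" "integrable ?L (\<lambda>x. (u0 x)\<^sup>2)"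
        "integrable ?L (\<lambda>x. (um x)\<^sup>2)"
      and p: "AE x in ?L. 0 \<le> u1 x" "AE x in ?L. 0 \<le> u0 x" "AE x in ?L. 0 \<le> um x"
      by (auto simp: L2_nonneg_def)
    have Gv: "G (v x) = \<nu> * ((u1 x)\<^sup>2 + (u0 x)\<^sup>2 + (um x)\<^sup>2) + \<mu> * ((u1 x)\<^sup>2 - (um x)\<^sup>2) - c" for x
      by (simp add: G_def v)
    have i2: "integrable ?L (\<lambda>x. \<nu> * ((u1 x)\<^sup>2 + (u0 x)\<^sup>2 + (um x)\<^sup>2))"
      "integrable ?L (\<lambda>x. \<mu> * ((u1 x)\<^sup>2 - (um x)\<^sup>2))"
      using i by (auto simp del: integrable_mult_right_iff intro!: integrable_mult_right)
    have "integrable ?L (\<lambda>x. G (v x))"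
      unfolding Gv using i2 by auto
    moreover have "(\<integral>x. G (v x) \<partial>?L) = K"
      unfolding Gv using i2 by (simp add: N M K_def sp)
    moreover have "(\<lambda>x. H_TF \<alpha> q (v x)) \<in> borel_measurable ?L"
      unfolding v H_TF_def by simp
    moreover have "AE x in ?L. G (v x) \<le> H_TF \<alpha> q (v x)"
      using p by eventually_elim (simp add: v bound)
    ultimately show ?thesis by blast
  qed
  have lower: "ereal K \<le> TF_energy \<alpha> q \<Omega> v \<and>
      (TF_energy \<alpha> q \<Omega> v = ereal K \<longrightarrow> (AE x in ?L. H_TF \<alpha> q (v x) = G (v x)))"
    if "v \<in> admissible \<Omega> N M" for v
  \<comment> \<open>An infinite energy exceeds \<open>K\<close> and cannot equal it; when it is
    finite, the Hamiltonian is integrable and the energy is a Bochner integral.\<close>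
  proof (cases "(\<integral>\<^sup>+x. ennreal (H_TF \<alpha> q (v x)) \<partial>?L) = \<infinity>")
    case True
    then show ?thesis by (simp add: en)
  next
    case False
    note a = adm[OF that]
    have iH: "integrable ?L (\<lambda>x. H_TF \<alpha> q (v x))"
      using a False nneg by (intro integrableI_nonneg) (auto simp: less_top)
    have e: "TF_energy \<alpha> q \<Omega> v = ereal (\<integral>x. H_TF \<alpha> q (v x) \<partial>?L)"
      unfolding en using iH nneg by (subst nn_integral_eq_integral) (auto simp: enn2ereal_ennreal)
    have "K \<le> (\<integral>x. H_TF \<alpha> q (v x) \<partial>?L)"
      using a iH integral_mono_AE[of ?L "\<lambda>x. G (v x)" "\<lambda>x. H_TF \<alpha> q (v x)"] by simp
    moreover have "AE x in ?L. H_TF \<alpha> q (v x) = G (v x)"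
      if "(\<integral>x. H_TF \<alpha> q (v x) \<partial>?L) = K"
    proof -
      \<comment> \<open>A function that is nonnegative almost everywhere and has integral zero
        vanishes almost everywhere.\<close>
      have "(\<integral>x. H_TF \<alpha> q (v x) - G (v x) \<partial>?L) = 0" using a iH that by simp
      then have "AE x in ?L. H_TF \<alpha> q (v x) - G (v x) = 0"
        using a iH by (subst (asm) integral_nonneg_eq_0_iff_AE) auto
      then show ?thesis by simp
    qed
    ultimately show ?thesis by (simp add: e)
  qed
  have ew: "TF_energy \<alpha> q \<Omega> w = ereal K"
  proof -
    note a = adm[OF w]
    have i: "integrable ?L (\<lambda>x. H_TF \<alpha> q (w x))"
      using integrable_cong_AE[of "\<lambda>x. H_TF \<alpha> q (w x)" ?L "\<lambda>x. G (w x)"] a weq by auto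
    have "(\<integral>x. H_TF \<alpha> q (w x) \<partial>?L) = K"
      using integral_cong_AE[of "\<lambda>x. H_TF \<alpha> q (w x)" ?L "\<lambda>x. G (w x)"] a weq by auto
    moreover have "TF_energy \<alpha> q \<Omega> w = ereal (\<integral>x. H_TF \<alpha> q (w x) \<partial>?L)"
      unfolding en using i nneg by (subst nn_integral_eq_integral) (auto simp: enn2ereal_ennreal)
    ultimately show ?thesis by simp
  qed
  show "P0_minimizer \<alpha> q N M \<Omega> w"
    using w lower ew by (auto simp: P0_minimizer_def is_arg_min_def not_less)
  assume u: "P0_minimizer \<alpha> q N M \<Omega> u"
  then have "u \<in> admissible \<Omega> N M" "TF_energy \<alpha> q \<Omega> u \<le> ereal K"
    using w ew by (auto simp: P0_minimizer_def is_arg_min_def not_less)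
  with lower[of u] show "AE x in ?L. H_TF \<alpha> q (u x) = G (u x)" by auto
qed

section \<open>The augmented Hamiltonian and its zeros\<close>

text \<open>In terms of \<open>y = u0\<^sup>2\<close> the gap is the quadratic
  \<open>y\<^sup>2 / 2 + y * (e - \<nu>) + F0\<close> on the half-line \<open>y \<ge> 0\<close>. If
  \<open>e \<ge> \<nu>\<close>, all three terms are nonnegative and can only vanish at
  \<open>y = 0\<close> and \<open>F0 = 0\<close>, which is the phase without \<open>u0\<close>. If
  \<open>e < \<nu>\<close>, the minimum over \<open>y\<close> is
  \<open>F0 - (\<nu> - e)\<^sup>2 / 2\<close>, which is positive unless \<open>s = 0\<close>; the
  case \<open>s = 0\<close> gives the pure \<open>u0\<close> phase.\<close>

lemma energy_gap:
  fixes \<alpha> q A B \<nu> u1 u0 um :: real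
  defines "gap \<equiv> H_TF \<alpha> q (u1, u0, um)
     - (\<nu> * (u1\<^sup>2 + u0\<^sup>2 + um\<^sup>2) + \<alpha> * B * (u1\<^sup>2 - um\<^sup>2) - \<nu>\<^sup>2 / 2)"
  assumes \<alpha>: "0 < \<alpha>" and q: "0 < q" and \<nu>: "\<nu> = A + q" "0 < \<nu>"
    and B: "\<alpha> * B\<^sup>2 = 2 * A * q + q\<^sup>2"
    and nonneg: "0 \<le> u1" "0 \<le> u0" "0 \<le> um"
  shows "0 \<le> gap"
    and "gap = 0 \<longleftrightarrow> (u0 = 0 \<and> u1\<^sup>2 + um\<^sup>2 = A \<and> u1\<^sup>2 - um\<^sup>2 = B) \<or>
           (u1 = 0 \<and> um = 0 \<and> u0\<^sup>2 = \<nu>)"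
proof -
  define s d w y where "s = u1\<^sup>2 + um\<^sup>2" and "d = u1\<^sup>2 - um\<^sup>2" and "w = 2 * u1 * um" and "y = u0\<^sup>2"
  have y: "0 \<le> y" and s: "0 \<le> s" by (auto simp: y_def s_def)
  \<comment> \<open>The triple \<open>(s, d, w)\<close> lies on a cone, which allows linear forms in
    \<open>d\<close> and \<open>w\<close> to be estimated by \<open>s\<close>.\<close>
  have sdw: "s\<^sup>2 = d\<^sup>2 + w\<^sup>2" by (simp add: s_def d_def w_def power2_eq_square algebra_simps)
  \<comment> \<open>Here \<open>s - w\<close> equals \<open>(u1 - um)\<^sup>2\<close>, so
    \<open>e\<close> collects what multiplies \<open>y\<close> in the gap apart from
    \<open>\<nu>\<close>.\<close>
  define e where "e = s + \<alpha> * (s - w)"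
  define F0 where "F0 = (s - A)\<^sup>2 / 2 + \<alpha> * (d - B)\<^sup>2 / 2"
  define K where "K = \<nu> * e - A * s - \<alpha> * B * d"
  have F0: "0 \<le> F0" "F0 = 0 \<longleftrightarrow> s = A \<and> d = B"
    using \<alpha> by (auto simp: F0_def add_nonneg_eq_0_iff)
  have gap1: "gap = y\<^sup>2 / 2 + y * (e - \<nu>) + F0"
  proof -
    have "gap = (s + y)\<^sup>2 / 2 + \<alpha> * y * (s - w) + \<alpha> * d\<^sup>2 / 2 + q * s
        - \<nu> * (s + y) - \<alpha> * B * d + \<nu>\<^sup>2 / 2"
      using \<alpha> by (simp add: gap_def H_TF_def s_def d_def w_def y_def power2_eq_square field_simps)
    also have "\<dots> = y\<^sup>2 / 2 + y * (e - \<nu>) + F0 + (2 * A * q + q\<^sup>2 - \<alpha> * B\<^sup>2) / 2"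
      unfolding e_def F0_def \<nu> by (simp add: power2_eq_square field_simps)
    finally show ?thesis using B by simp
  qed
  have \<nu>2: "\<nu>\<^sup>2 = A\<^sup>2 + \<alpha> * B\<^sup>2" using B \<nu> by (simp add: power2_eq_square algebra_simps)
  have K_pos: "0 < K" if "0 < s"
  proof -
    \<comment> \<open>Lagrange's identity for the vectors \<open>(\<nu>, B)\<close> and
      \<open>(w, d)\<close>; dropping the second square gives the Cauchy-Schwarz inequality.\<close>
    have "(\<nu> * w + B * d)\<^sup>2 + (\<nu> * d - B * w)\<^sup>2 = (\<nu>\<^sup>2 + B\<^sup>2) * s\<^sup>2"
      unfolding sdw by (simp add: power2_eq_square algebra_simps)
    then have "(\<nu> * w + B * d)\<^sup>2 \<le> (\<nu>\<^sup>2 + B\<^sup>2) * s\<^sup>2"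
      using zero_le_power2[of "\<nu> * d - B * w"] by linarith
    then have "\<alpha>\<^sup>2 * (\<nu> * w + B * d)\<^sup>2 \<le> \<alpha>\<^sup>2 * ((\<nu>\<^sup>2 + B\<^sup>2) * s\<^sup>2)"
      by (rule mult_left_mono) simp
    also have "\<dots> = (\<alpha>\<^sup>2 * \<nu>\<^sup>2 + \<alpha> * (\<alpha> * B\<^sup>2)) * s\<^sup>2"
      by (simp add: power2_eq_square algebra_simps)
    \<comment> \<open>The relation for \<open>\<alpha> * B\<^sup>2\<close> leaves the surplus
      \<open>(1 + \<alpha>) * q\<^sup>2\<close>, which makes the bound strict.\<close>
    also have "\<dots> < (q + \<alpha> * \<nu>)\<^sup>2 * s\<^sup>2"
    proof (rule mult_strict_right_mono)
      have "(q + \<alpha> * \<nu>)\<^sup>2 = \<alpha>\<^sup>2 * \<nu>\<^sup>2 + \<alpha> * (2 * A * q + q\<^sup>2) + (1 + \<alpha>) * q\<^sup>2"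
        by (simp add: \<nu> power2_eq_square algebra_simps)
      moreover have "0 < (1 + \<alpha>) * q\<^sup>2" using \<alpha> q by simp
      ultimately show "\<alpha>\<^sup>2 * \<nu>\<^sup>2 + \<alpha> * (\<alpha> * B\<^sup>2) < (q + \<alpha> * \<nu>)\<^sup>2"
        unfolding B by linarith
    qed (use that in simp)
    finally have "(\<alpha> * (\<nu> * w + B * d))\<^sup>2 < ((q + \<alpha> * \<nu>) * s)\<^sup>2"
      by (simp add: power_mult_distrib)
    then have "\<alpha> * (\<nu> * w + B * d) < (q + \<alpha> * \<nu>) * s"
      by (rule power2_less_imp_less) (use \<alpha> q \<nu> s in simp)
    then show ?thesis by (simp add: K_def e_def \<nu> algebra_simps)
  qed
  have F2_pos: "0 < F0 - (\<nu> - e)\<^sup>2 / 2" if "0 < s" "e < \<nu>"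
  proof -
    \<comment> \<open>Along a ray through the origin in the \<open>(s, d)\<close> plane the quantity is \<open>t\<close> times an affine
      function of \<open>t\<close>; the two summands come from its values at \<open>t = 0\<close> and at \<open>e = \<nu>\<close>.\<close>
    have "\<nu>\<^sup>2 * (F0 - (\<nu> - e)\<^sup>2 / 2)
        = \<nu> * (\<nu> - e) * K + ((\<nu> * s - e * A)\<^sup>2 + \<alpha> * (\<nu> * d - e * B)\<^sup>2) / 2
          + (\<nu>\<^sup>2 - e\<^sup>2) * (A\<^sup>2 + \<alpha> * B\<^sup>2 - \<nu>\<^sup>2) / 2"
      unfolding F0_def K_def by (simp add: power2_eq_square field_simps)
    also have "\<dots> > 0"
      \<comment> \<open>The last summand is zero because
        \<open>\<nu>\<^sup>2 = A\<^sup>2 + \<alpha> * B\<^sup>2\<close>; the first is strictly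
        positive.\<close>
      unfolding \<nu>2[symmetric] using K_pos[OF that(1)] that \<nu>(2) \<alpha> by (simp add: add_pos_nonneg)
    finally show ?thesis using \<nu>(2) by (simp add: zero_less_mult_iff)
  qed
  have s0: "s = 0 \<longleftrightarrow> u1 = 0 \<and> um = 0" by (simp add: s_def sum_power2_eq_zero_iff)
  have gap_s0: "gap = (y - \<nu>)\<^sup>2 / 2" if "s = 0"
  proof -
    have "d = 0" "w = 0" using that s0 by (auto simp: d_def w_def)
    then show ?thesis
      using that \<nu>2 by (simp add: gap1 F0_def e_def power2_eq_square field_simps)
  qed
  have main: "0 \<le> gap \<and> (gap = 0 \<longrightarrow> (y = 0 \<and> s = A \<and> d = B) \<or> (s = 0 \<and> y = \<nu>))"
  proof (cases "s = 0")
    case True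
    then show ?thesis by (simp add: gap_s0)
  next
    case False
    then have s: "0 < s" using s by simp
    show ?thesis
    proof (cases "e < \<nu>")
      case True
      \<comment> \<open>Completing the square in \<open>y\<close>.\<close>
      have "gap = (y - (\<nu> - e))\<^sup>2 / 2 + (F0 - (\<nu> - e)\<^sup>2 / 2)"
        by (simp add: gap1 power2_eq_square field_simps)
      then have "0 < gap"
        using F2_pos[OF s True] zero_le_power2[of "y - (\<nu> - e)"] by linarith
      then show ?thesis by simp
    next
      case False
      then have "0 \<le> y * (e - \<nu>)" using y by simp
      moreover have "0 \<le> y\<^sup>2 / 2" by simp
      ultimately have "0 \<le> gap" "gap = 0 \<Longrightarrow> y\<^sup>2 / 2 = 0 \<and> F0 = 0"
        using gap1 F0(1) by linarith+
      then show ?thesis using F0(2) by simp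
    qed
  qed
  then show "0 \<le> gap" by simp
  have "gap = 0" if "y = 0" "s = A" "d = B" using that F0 by (simp add: gap1)
  then have "gap = 0 \<longleftrightarrow> (y = 0 \<and> s = A \<and> d = B) \<or> (s = 0 \<and> y = \<nu>)"
    using main gap_s0 by auto
  then show "gap = 0 \<longleftrightarrow> (u0 = 0 \<and> u1\<^sup>2 + um\<^sup>2 = A \<and> u1\<^sup>2 - um\<^sup>2 = B) \<or>
           (u1 = 0 \<and> um = 0 \<and> u0\<^sup>2 = \<nu>)"
    by (auto simp: s0 y_def) (auto simp: s_def d_def)
qed

section \<open>The volume fraction as a root of the cubic\<close>

text \<open>The lower bound on \<open>q\<close> makes the cubic change sign between 0 and 1. The
  upper bound is used through its critical case: \<open>A = B\<close> means
  \<open>(k - 1) * A = q\<close> with \<open>k = sqrt (\<alpha> + 1)\<close>. If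
  \<open>A < B\<close>, then both \<open>(k - 1) * A\<close> and \<open>(k - 1) * B\<close> stay
  below \<open>q\<close>, and expressing \<open>n\<close> and \<open>m\<close> by \<open>A\<close>,
  \<open>B\<close>, \<open>r\<close> contradicts the upper bound.\<close>

lemma cubic_root:
  fixes \<alpha> q n m :: real
  assumes \<alpha>: "0 < \<alpha>" and m: "0 < m" and n: "0 < n"
    and q1: "- n + sqrt (n\<^sup>2 + \<alpha> * m\<^sup>2) < q"
    and q2: "q < (1 - 1 / sqrt (\<alpha> + 1)) * (n + (sqrt (\<alpha> + 1) - 1) * m)"
  obtains r where "0 < r" "r < 1" "2 * q\<^sup>2 * r ^ 3 + (2 * q * n - q\<^sup>2) * r\<^sup>2 - \<alpha> * m\<^sup>2 = 0"
    and "m / r \<le> n + (r - 1) * q"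
proof -
  \<comment> \<open>The lower bound on \<open>q\<close> is itself nonnegative.\<close>
  have "sqrt (n\<^sup>2) \<le> sqrt (n\<^sup>2 + \<alpha> * m\<^sup>2)" using \<alpha> by (intro real_sqrt_le_mono) simp
  then have q: "0 < q" using q1 n by simp
  define f where "f r = 2 * q\<^sup>2 * r ^ 3 + (2 * q * n - q\<^sup>2) * r\<^sup>2 - \<alpha> * m\<^sup>2" for r
  have "sqrt (n\<^sup>2 + \<alpha> * m\<^sup>2) < n + q" using q1 by simp
  then have "n\<^sup>2 + \<alpha> * m\<^sup>2 < (n + q)\<^sup>2" using q n real_less_rsqrt real_sqrt_less_iff
    by (metis add_pos_pos real_sqrt_unique less_le)
  \<comment> \<open>The value \<open>f 1\<close> is
    \<open>(n + q)\<^sup>2 - n\<^sup>2 - \<alpha> * m\<^sup>2\<close>.\<close>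
  then have f1: "0 < f 1" by (simp add: f_def power2_eq_square algebra_simps)
  have f0: "f 0 < 0" using \<alpha> m by (simp add: f_def)
  have "\<forall>r. isCont f r" unfolding f_def by (auto intro!: continuous_intros)
  then obtain r where r: "0 \<le> r" "r \<le> 1" "f r = 0"
    using IVT[of f 0 0 1] f0 f1 by auto
  have r01: "0 < r" "r < 1" using r f0 f1 by (auto simp: less_le)
  define A B where "A = n + (r - 1) * q" and "B = m / r"
  have B: "0 < B" using m r01 by (simp add: B_def)
  have mB: "m = r * B" and nA: "n = A + (1 - r) * q"
    using r01 by (auto simp: A_def B_def algebra_simps)
  have "r\<^sup>2 * (2 * A * q + q\<^sup>2 - \<alpha> * B\<^sup>2) = f r"
    unfolding f_def mB nA by (simp add: power2_eq_square power3_eq_cube algebra_simps)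
  then have rel: "\<alpha> * B\<^sup>2 = 2 * A * q + q\<^sup>2" using r r01 by simp
  have "B \<le> A"
  proof (rule ccontr)
    assume "\<not> B \<le> A"
    then have AB: "A < B" by simp
    define k where "k = sqrt (\<alpha> + 1)"
    have k: "1 < k" and k2: "\<alpha> = k\<^sup>2 - 1" using \<alpha> by (auto simp: k_def)
    have kA: "(k - 1) * A < q"
    proof (cases "A \<le> 0")
      case True
      then show ?thesis using q k by (smt (verit) mult_nonneg_nonpos)
    next
      case False
      then have "A\<^sup>2 < B\<^sup>2" using AB by (intro power_strict_mono) auto
      then have "\<alpha> * A\<^sup>2 < \<alpha> * B\<^sup>2" using \<alpha> by simp
      \<comment> \<open>Adding \<open>A\<^sup>2\<close> to both sides turns them into the squares of
        \<open>k * A\<close> and \<open>A + q\<close>.\<close>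
      then have "(k\<^sup>2 - 1) * A\<^sup>2 < 2 * A * q + q\<^sup>2"
        unfolding rel unfolding k2 .
      then have "(k * A)\<^sup>2 < (A + q)\<^sup>2"
        by (simp add: power2_eq_square algebra_simps)
      then have "k * A < A + q" by (rule power2_less_imp_less) (use False q in simp)
      then show ?thesis by (simp add: algebra_simps)
    qed
    have kB: "(k - 1) * B < q"
    proof -
      \<comment> \<open>The factor \<open>k + 1\<close> is chosen so that
        \<open>(k + 1) * (k - 1) = \<alpha>\<close> brings in the relation for
        \<open>\<alpha> * B\<^sup>2\<close>, after which \<open>kA\<close> applies.\<close>
      have "(k + 1) * ((k - 1) * B)\<^sup>2 = (k - 1) * (\<alpha> * B\<^sup>2)"
        by (simp add: k2 power2_eq_square algebra_simps)
      also have "\<dots> = 2 * ((k - 1) * A) * q + (k - 1) * q\<^sup>2"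
        unfolding rel by (simp add: power2_eq_square algebra_simps)
      also have "\<dots> < 2 * q * q + (k - 1) * q\<^sup>2" using kA q by simp
      also have "\<dots> = (k + 1) * q\<^sup>2" by (simp add: power2_eq_square algebra_simps)
      finally have "((k - 1) * B)\<^sup>2 < q\<^sup>2" using k by simp
      then show ?thesis by (rule power2_less_imp_less) (use q in simp)
    qed
    \<comment> \<open>This is the upper bound on \<open>q\<close> multiplied by
      \<open>k\<close>.\<close>
    have "k * q < (k - 1) * (n + (k - 1) * m)"
      using q2[folded k_def] k by (simp add: field_simps)
    also have "\<dots> = (k - 1) * A + (1 - r) * ((k - 1) * q) + r * (k - 1) * ((k - 1) * B)"
      unfolding nA mB by (simp add: algebra_simps)
    also have "\<dots> \<le> q + (1 - r) * ((k - 1) * q) + r * (k - 1) * q"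
      using kA kB k r01 by (intro add_mono mult_left_mono) auto
    also have "\<dots> = k * q" by (simp add: algebra_simps)
    finally show False by simp
  qed
  then show ?thesis using that r01 r(3) by (simp add: A_def B_def f_def)
qed

section \<open>Two-phase functions and the constraints\<close>

lemma indicator_mult_L2_nonneg:
  assumes "V \<in> sets lebesgue" "V \<subseteq> \<Omega>" "\<Omega> \<in> lmeasurable" "0 \<le> c"
  shows "(\<lambda>x. indicator V x * c) \<in> L2_nonneg \<Omega>"
proof -
  interpret finite_measure "lebesgue_on \<Omega>"
    using assms(3) by (rule finite_measure_lebesgue_on)
  have V: "V \<in> sets (lebesgue_on \<Omega>)" using assms by (auto simp: sets_restrict_space_iff)
  then have "integrable (lebesgue_on \<Omega>) (\<lambda>x. indicator V x * c\<^sup>2)"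
    by (intro integrable_mult_left) (auto simp: integrable_real_indicator less_top[symmetric])
  moreover have "(\<lambda>x. (indicator V x * c)\<^sup>2) = (\<lambda>x. indicator V x * c\<^sup>2)"
    by (auto simp: indicator_def)
  ultimately show ?thesis
    using V assms(4) by (auto simp: L2_nonneg_def)
qed

lemma integral_lebesgue_on_indicator_mult:
  assumes "V \<in> sets lebesgue" "V \<subseteq> \<Omega>" "\<Omega> \<in> lmeasurable"
  shows "(\<integral>x. indicator V x * c \<partial>lebesgue_on \<Omega>) = measure lebesgue V * c"
  using assms
  by (simp add: measure_restrict_space Int_absorb2)

text \<open>The densities are constant on each phase, so both constraint integrals are sums weighted
  by the volumes; the phase on \<open>\<Omega> - U\<close> carries no magnetization.\<close>

lemma two_phase_admissible:
  assumes \<Omega>: "\<Omega> \<in> lmeasurable" and U: "U \<in> sets lebesgue" "U \<subseteq> \<Omega>"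
    and nonneg: "0 \<le> a1" "0 \<le> am" "0 \<le> b0"
    and N: "measure lebesgue U * (a1\<^sup>2 + am\<^sup>2) + (measure lebesgue \<Omega> - measure lebesgue U) * b0\<^sup>2 = N"
    and M: "measure lebesgue U * (a1\<^sup>2 - am\<^sup>2) = M"
  shows "(\<lambda>x. indicator U x *\<^sub>R (a1, 0, am) + indicator (\<Omega> - U) x *\<^sub>R (0, b0, 0)) \<in> admissible \<Omega> N M"
proof -
  let ?V = "\<Omega> - U" and ?L = "lebesgue_on \<Omega>"
  interpret finite_measure ?L
    using \<Omega> by (rule finite_measure_lebesgue_on)
  have V: "?V \<in> sets lebesgue" "?V \<subseteq> \<Omega>" using \<Omega> U by auto
  have mV: "measure lebesgue ?V = measure lebesgue \<Omega> - measure lebesgue U"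
    using \<Omega> U by (intro measure_Diff) (auto simp: fmeasurable_def)
  have i: "integrable ?L (\<lambda>x. indicator W x * c)" if "W \<in> sets lebesgue" "W \<subseteq> \<Omega>" for W and c :: real
    using that \<Omega> by (intro integrable_mult_left)
      (auto simp: integrable_real_indicator sets_restrict_space_iff less_top[symmetric])
  let ?u1 = "\<lambda>x. indicator U x * a1" and ?u0 = "\<lambda>x. indicator ?V x * b0" and ?um = "\<lambda>x. indicator U x * am"
  have "(\<integral>x. (?u1 x)\<^sup>2 + (?u0 x)\<^sup>2 + (?um x)\<^sup>2 \<partial>?L)
      = (\<integral>x. indicator U x * (a1\<^sup>2 + am\<^sup>2) + indicator ?V x * b0\<^sup>2 \<partial>?L)"
    by (rule Bochner_Integration.integral_cong) (auto simp: indicator_def)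
  also have "\<dots> = N"
    using N by (subst Bochner_Integration.integral_add)
      (simp_all only: i U V integral_lebesgue_on_indicator_mult \<Omega> mV)
  finally have 1: "(\<integral>x. (?u1 x)\<^sup>2 + (?u0 x)\<^sup>2 + (?um x)\<^sup>2 \<partial>?L) = N" .
  have "(\<integral>x. (?u1 x)\<^sup>2 - (?um x)\<^sup>2 \<partial>?L) = (\<integral>x. indicator U x * (a1\<^sup>2 - am\<^sup>2) \<partial>?L)"
    by (rule Bochner_Integration.integral_cong) (auto simp: indicator_def)
  also have "\<dots> = M"
    unfolding integral_lebesgue_on_indicator_mult[OF U \<Omega>] by (rule M)
  finally have 2: "(\<integral>x. (?u1 x)\<^sup>2 - (?um x)\<^sup>2 \<partial>?L) = M" .
  show ?thesis
    unfolding admissible_def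
    by (rule CollectI, rule exI[of _ ?u1], rule exI[of _ ?u0], rule exI[of _ ?um])
      (use 1 2 in \<open>auto intro!: indicator_mult_L2_nonneg U V \<Omega> nonneg\<close>)
qed

section \<open>The gap without magnetization\<close>

text \<open>With mass multiplier \<open>n\<close> and magnetization multiplier 0, the gap is a sum
  of three nonnegative terms: a squared mass defect, the spin interaction and the \<open>q\<close>
  term. The last one forces \<open>u1\<close> and \<open>um\<close> to vanish, and the first then
  fixes \<open>u0\<close>.\<close>

lemma energy_gap_unmagnetized:
  fixes \<alpha> q n u1 u0 um :: real
  defines "gap \<equiv> H_TF \<alpha> q (u1, u0, um) - (n * (u1\<^sup>2 + u0\<^sup>2 + um\<^sup>2) - n\<^sup>2 / 2)"
  assumes \<alpha>: "0 < \<alpha>" and q: "0 < q"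
  shows "0 \<le> gap" and "gap = 0 \<longleftrightarrow> u1 = 0 \<and> um = 0 \<and> u0\<^sup>2 = n"
proof -
  define P Q R where "P = (u1\<^sup>2 + u0\<^sup>2 + um\<^sup>2 - n)\<^sup>2 / 2"
    and "Q = \<alpha> / 2 * (2 * u0\<^sup>2 * (u1 - um)\<^sup>2 + (u1\<^sup>2 - um\<^sup>2)\<^sup>2)" and "R = q * (u1\<^sup>2 + um\<^sup>2)"
  have gap: "gap = P + Q + R"
    using \<alpha> by (simp add: gap_def H_TF_def P_def Q_def R_def power2_eq_square field_simps)
  have nonneg: "0 \<le> P" "0 \<le> Q" "0 \<le> R" using \<alpha> q by (auto simp: P_def Q_def R_def)
  then show "0 \<le> gap" by (simp add: gap)
  have R0: "R = 0 \<longleftrightarrow> u1 = 0 \<and> um = 0" using q by (simp add: R_def sum_power2_eq_zero_iff)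
  have "gap = 0 \<longleftrightarrow> P = 0 \<and> Q = 0 \<and> R = 0" using nonneg gap by linarith
  also have "\<dots> \<longleftrightarrow> u1 = 0 \<and> um = 0 \<and> u0\<^sup>2 = n"
    unfolding R0 by (auto simp: P_def Q_def)
  finally show "gap = 0 \<longleftrightarrow> u1 = 0 \<and> um = 0 \<and> u0\<^sup>2 = n" .
qed

section \<open>Existence and shape of the minimizers\<close>

text \<open>A minimizer is built by placing \<open>a\<close> on any part of \<open>\<Omega>\<close>
  with volume fraction \<open>r\<close>. Conversely a minimizer has zero gap, hence takes only the
  values \<open>a\<close> and \<open>b\<close>, and its magnetization determines the volume of the
  phase \<open>a\<close>.\<close>

lemma two_phase_minimizers:
  fixes \<Omega> :: "'a::euclidean_space set" and \<alpha> q N M A B r :: real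
  defines "W \<equiv> measure lebesgue \<Omega>"
  defines "a \<equiv> (sqrt ((A + B) / 2), 0, sqrt ((A - B) / 2))"
    and "b \<equiv> (0, root 4 (A\<^sup>2 + \<alpha> * B\<^sup>2), 0)"
  assumes \<Omega>: "\<Omega> \<in> lmeasurable" "0 < W" and \<alpha>: "0 < \<alpha>" and q: "0 < q"
    and AB: "0 < B" "B \<le> A" "\<alpha> * B\<^sup>2 = 2 * A * q + q\<^sup>2"
    and r: "0 < r" "r < 1"
    and N: "W * (A + (1 - r) * q) = N" and M: "W * (r * B) = M"
  shows "\<exists>u. P0_minimizer \<alpha> q N M \<Omega> u"
    and "P0_minimizer \<alpha> q N M \<Omega> u \<Longrightarrow> \<exists>U. U \<in> sets lebesgue \<and> U \<subseteq> \<Omega> \<and> r = measure lebesgue U / W \<and>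
      (AE x in lebesgue_on \<Omega>. u x = indicator U x *\<^sub>R a + indicator (\<Omega> - U) x *\<^sub>R b)"
proof -
  define \<nu> where "\<nu> = A + q"
  have \<nu>: "0 < \<nu>" using AB q by (simp add: \<nu>_def)
  define a1 am b0 where "a1 = sqrt ((A + B) / 2)" and "am = sqrt ((A - B) / 2)"
    and "b0 = root 4 (A\<^sup>2 + \<alpha> * B\<^sup>2)"
  have a: "a = (a1, 0, am)" and b: "b = (0, b0, 0)" by (simp_all add: a_def b_def a1_def am_def b0_def)
  have a1: "0 < a1" and am: "0 \<le> am" and sq: "a1\<^sup>2 = (A + B) / 2" "am\<^sup>2 = (A - B) / 2"
    using AB by (auto simp: a1_def am_def)
  \<comment> \<open>Both sides equal \<open>\<nu>\<^sup>2\<close>, so the fourth root in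
    \<open>b\<close> is \<open>sqrt \<nu>\<close>.\<close>
  have "A\<^sup>2 + \<alpha> * B\<^sup>2 = sqrt \<nu> ^ 4"
    using AB(3) \<nu> power_mult[of "sqrt \<nu>" 2 2]
    by (simp add: \<nu>_def power2_eq_square algebra_simps)
  then have b0: "b0 = sqrt \<nu>"
    using \<nu> by (simp add: b0_def real_root_power_cancel)
  have gap: "\<nu> * (u1\<^sup>2 + u0\<^sup>2 + um\<^sup>2) + \<alpha> * B * (u1\<^sup>2 - um\<^sup>2) - \<nu>\<^sup>2 / 2 \<le> H_TF \<alpha> q (u1, u0, um)"
    "H_TF \<alpha> q (u1, u0, um) = \<nu> * (u1\<^sup>2 + u0\<^sup>2 + um\<^sup>2) + \<alpha> * B * (u1\<^sup>2 - um\<^sup>2) - \<nu>\<^sup>2 / 2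
      \<longleftrightarrow> (u1, u0, um) = a \<or> (u1, u0, um) = b"
    if nn: "0 \<le> u1" "0 \<le> u0" "0 \<le> um" for u1 u0 um
  proof -
    note g = energy_gap[OF \<alpha> q \<nu>_def \<nu> AB(3) nn]
    from g(1) show "\<nu> * (u1\<^sup>2 + u0\<^sup>2 + um\<^sup>2) + \<alpha> * B * (u1\<^sup>2 - um\<^sup>2) - \<nu>\<^sup>2 / 2 \<le> H_TF \<alpha> q (u1, u0, um)"
      by simp
    have "u1\<^sup>2 + um\<^sup>2 = A \<and> u1\<^sup>2 - um\<^sup>2 = B \<longleftrightarrow> u1\<^sup>2 = a1\<^sup>2 \<and> um\<^sup>2 = am\<^sup>2"
      unfolding sq by (auto simp: field_simps)
    then have "u1\<^sup>2 + um\<^sup>2 = A \<and> u1\<^sup>2 - um\<^sup>2 = B \<longleftrightarrow> u1 = a1 \<and> um = am"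
      using nn a1 am by (simp add: power2_eq_iff_nonneg)
    moreover have "u0\<^sup>2 = \<nu> \<longleftrightarrow> u0 = b0"
      using nn \<nu> by (auto simp: b0)
    ultimately show "H_TF \<alpha> q (u1, u0, um) = \<nu> * (u1\<^sup>2 + u0\<^sup>2 + um\<^sup>2) + \<alpha> * B * (u1\<^sup>2 - um\<^sup>2) - \<nu>\<^sup>2 / 2
      \<longleftrightarrow> (u1, u0, um) = a \<or> (u1, u0, um) = b"
      using g(2) unfolding a b by auto
  qed
  \<comment> \<open>The phases of the constructed minimizer are separated by a coordinate
    hyperplane; such hyperplanes are null sets, so every volume fraction can be cut off.\<close>
  obtain e :: 'a where e: "e \<in> Basis" using nonempty_Basis by blast
  have null: "{x. x \<bullet> e = t} \<in> null_sets lebesgue" for t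
    using negligible_standard_hyperplane[OF e] by (simp add: negligible_iff_null_sets)
  have "(\<lambda>x::'a. x \<bullet> e) \<in> borel_measurable borel" by simp
  moreover have "0 < r * W" "r * W < measure lebesgue \<Omega>"
    using r \<Omega>(2) by (simp_all flip: W_def)
  ultimately obtain t where t: "measure lebesgue {x \<in> \<Omega>. x \<bullet> e \<le> t} = r * W"
    using exists_sublevel_measure[OF \<Omega>(1) _ null] by metis
  define U0 where "U0 = {x \<in> \<Omega>. x \<bullet> e \<le> t}"
  have "{x. x \<bullet> e \<le> t} \<in> sets lebesgue"
    by (intro sets_completionI_sets) simp
  moreover have "U0 = \<Omega> \<inter> {x. x \<bullet> e \<le> t}" by (auto simp: U0_def)
  ultimately have U0: "U0 \<in> sets lebesgue" "U0 \<subseteq> \<Omega>"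
    using fmeasurableD[OF \<Omega>(1)] by (simp_all only: sets.Int Int_lower1)
  define w where "w = (\<lambda>x. indicator U0 x *\<^sub>R a + indicator (\<Omega> - U0) x *\<^sub>R b)"
  have w: "w \<in> admissible \<Omega> N M"
    unfolding w_def a b
  proof (rule two_phase_admissible[OF \<Omega>(1) U0])
    show "measure lebesgue U0 * (a1\<^sup>2 + am\<^sup>2) + (measure lebesgue \<Omega> - measure lebesgue U0) * b0\<^sup>2 = N"
      using \<nu> t unfolding U0_def[symmetric] W_def[symmetric] N[symmetric] sq b0
      by (simp add: \<nu>_def field_simps)
    show "measure lebesgue U0 * (a1\<^sup>2 - am\<^sup>2) = M"
      using t unfolding U0_def[symmetric] M[symmetric] sq by (simp add: field_simps)
  qed (use a1 am \<nu> b0 in auto)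
  have wab: "w x = a \<or> w x = b" if "x \<in> \<Omega>" for x
    using that by (auto simp: w_def indicator_def)
  note gapa = gap(2)[of a1 0 am] and gapb = gap(2)[of 0 b0 0]
  let ?G = "\<lambda>(u1, u0, um). \<nu> * (u1\<^sup>2 + u0\<^sup>2 + um\<^sup>2) + \<alpha> * B * (u1\<^sup>2 - um\<^sup>2) - \<nu>\<^sup>2 / 2"
  have "AE x in lebesgue_on \<Omega>. H_TF \<alpha> q (w x) = ?G (w x)"
  proof (rule AE_I2)
    fix x assume "x \<in> space (lebesgue_on \<Omega>)"
    then have "x \<in> \<Omega>" by simp
    from wab[OF this] show "H_TF \<alpha> q (w x) = ?G (w x)"
      using gapa gapb a1 am \<nu> b0 by (auto simp: a b)
  qed
  note min = multiplier_minimizer[OF \<Omega>(1) _ _ _ w this]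
  show "\<exists>u. P0_minimizer \<alpha> q N M \<Omega> u"
    using min(1) \<alpha> q gap(1) by (intro exI[of _ w]) auto
  assume u: "P0_minimizer \<alpha> q N M \<Omega> u"
  then have "u \<in> admissible \<Omega> N M" by (simp add: P0_minimizer_def is_arg_min_def)
  then obtain u1 u0 um where v: "u = (\<lambda>x. (u1 x, u0 x, um x))"
    and L2: "u1 \<in> L2_nonneg \<Omega>" "u0 \<in> L2_nonneg \<Omega>" "um \<in> L2_nonneg \<Omega>"
    and M': "(\<integral>x. (u1 x)\<^sup>2 - (um x)\<^sup>2 \<partial>lebesgue_on \<Omega>) = M"
    by (auto simp: admissible_def)
  from L2 have [measurable]: "u1 \<in> borel_measurable (lebesgue_on \<Omega>)" "um \<in> borel_measurable (lebesgue_on \<Omega>)"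
    and p: "AE x in lebesgue_on \<Omega>. 0 \<le> u1 x" "AE x in lebesgue_on \<Omega>. 0 \<le> u0 x"
      "AE x in lebesgue_on \<Omega>. 0 \<le> um x"
    by (auto simp: L2_nonneg_def)
  have "AE x in lebesgue_on \<Omega>. H_TF \<alpha> q (u x) = ?G (u x)"
    using min(2)[OF _ _ _ u] \<alpha> q gap(1) by auto
  then have ab: "AE x in lebesgue_on \<Omega>. u x = a \<or> u x = b"
    using p by eventually_elim (simp add: v gap(2))
  \<comment> \<open>The first component tells the phases apart: it is \<open>a1 > 0\<close> in
    \<open>a\<close> and 0 in \<open>b\<close>.\<close>
  define U where "U = {x \<in> space (lebesgue_on \<Omega>). u1 x = a1}"
  have UL: "U \<in> sets (lebesgue_on \<Omega>)" unfolding U_def by measurable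
  then have U: "U \<in> sets lebesgue" "U \<subseteq> \<Omega>"
    using \<Omega>(1) by (auto simp: sets_restrict_space_iff)
  have dB: "a1\<^sup>2 - am\<^sup>2 = B" unfolding sq by (simp add: field_simps)
  have "(\<integral>x. (u1 x)\<^sup>2 - (um x)\<^sup>2 \<partial>lebesgue_on \<Omega>) = (\<integral>x. indicator U x * B \<partial>lebesgue_on \<Omega>)"
  proof (rule integral_cong_AE)
    show "AE x in lebesgue_on \<Omega>. (u1 x)\<^sup>2 - (um x)\<^sup>2 = indicator U x * B"
      using ab AE_space
      by eventually_elim (use a1 dB in \<open>auto simp: v a b U_def indicator_def\<close>)
  qed (use UL in auto)
  \<comment> \<open>Only the phase \<open>a\<close> is magnetized, with density \<open>B\<close>;
    cancelling \<open>B > 0\<close> gives the volume fraction.\<close>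
  then have "measure lebesgue U * B = r * W * B"
    unfolding M' integral_lebesgue_on_indicator_mult[OF U \<Omega>(1)] M[symmetric] by (auto simp: mult_ac)
  then have "r = measure lebesgue U / W" using AB(1) \<Omega>(2) by simp
  moreover have "AE x in lebesgue_on \<Omega>. u x = indicator U x *\<^sub>R a + indicator (\<Omega> - U) x *\<^sub>R b"
    using ab AE_space by eventually_elim (use a1 in \<open>auto simp: v a b U_def indicator_def\<close>)
  ultimately show "\<exists>U. U \<in> sets lebesgue \<and> U \<subseteq> \<Omega> \<and> r = measure lebesgue U / W \<and>
      (AE x in lebesgue_on \<Omega>. u x = indicator U x *\<^sub>R a + indicator (\<Omega> - U) x *\<^sub>R b)"
    using U by blast
qed

lemma unmagnetized_minimizers:
  fixes \<Omega> :: "'a::euclidean_space set" and \<alpha> q N n :: real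
  defines "w \<equiv> \<lambda>x. indicator \<Omega> x *\<^sub>R (0, sqrt n, 0)"
  assumes \<Omega>: "\<Omega> \<in> lmeasurable" and \<alpha>: "0 < \<alpha>" and q: "0 < q"
    and n: "0 < n" "measure lebesgue \<Omega> * n = N"
  shows "P0_minimizer \<alpha> q N 0 \<Omega> w"
    and "P0_minimizer \<alpha> q N 0 \<Omega> u \<Longrightarrow> AE x in lebesgue_on \<Omega>. u x = w x"
proof -
  note gap = energy_gap_unmagnetized[OF \<alpha> q]
  have w: "w \<in> admissible \<Omega> N 0"
    \<comment> \<open>The constant state is the two-phase function whose magnetized phase is
      empty.\<close>
    using two_phase_admissible[of \<Omega> "{}" 0 0 "sqrt n" N 0] \<Omega> n by (simp add: w_def zero_prod_def)
  \<comment> \<open>The zero term keeps the shape required by \<open>multiplier_minimizer\<close>,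
    with \<open>\<mu> = 0\<close>.\<close>
  let ?G = "\<lambda>(u1, u0, um). n * (u1\<^sup>2 + u0\<^sup>2 + um\<^sup>2) + 0 * (u1\<^sup>2 - um\<^sup>2) - n\<^sup>2 / 2"
  have "AE x in lebesgue_on \<Omega>. H_TF \<alpha> q (w x) = ?G (w x)"
    using gap(2)[of 0 "sqrt n" 0 n] n by (intro AE_I2) (auto simp: w_def)
  note min = multiplier_minimizer[OF \<Omega> _ _ _ w this]
  show "P0_minimizer \<alpha> q N 0 \<Omega> w"
    using min(1) \<alpha> q gap(1) by auto
  assume u: "P0_minimizer \<alpha> q N 0 \<Omega> u"
  then have "u \<in> admissible \<Omega> N 0" by (simp add: P0_minimizer_def is_arg_min_def)
  then obtain u1 u0 um where v: "u = (\<lambda>x. (u1 x, u0 x, um x))" and "u0 \<in> L2_nonneg \<Omega>"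
    by (auto simp: admissible_def)
  then have p: "AE x in lebesgue_on \<Omega>. 0 \<le> u0 x" by (auto simp: L2_nonneg_def)
  have "AE x in lebesgue_on \<Omega>. H_TF \<alpha> q (u x) = ?G (u x)"
    using min(2)[OF _ _ _ u] \<alpha> q gap(1) by auto
  then show "AE x in lebesgue_on \<Omega>. u x = w x"
    using p AE_space
  proof eventually_elim
    case (elim x)
    then have "u1 x = 0" "um x = 0" "(u0 x)\<^sup>2 = n" using gap(2)[of "u1 x" "u0 x" "um x" n] by (auto simp: v)
    then show ?case using elim by (auto simp: v w_def)
  qed
qed

section \<open>The magnetized and unmagnetized cases under the bounds on \<open>q\<close>\<close>

theorem theorem3p3:
  fixes \<Omega> :: "(real ^ 3) set" and \<alpha> q N M n m q1 q2 :: real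
  assumes "bounded_smooth_domain \<Omega>"
    and "N > 0" and "0 \<le> M" and "M \<le> N"
    and "n = N / measure lebesgue \<Omega>" and "m = M / measure lebesgue \<Omega>"
    and "0 < \<alpha>" and "\<alpha> \<le> 1" and "m \<ge> 0"
    and "q1 = - n + sqrt (n\<^sup>2 + \<alpha> * m\<^sup>2)"
    and "q2 = (1 - 1 / sqrt (\<alpha> + 1)) * (n + (sqrt (\<alpha> + 1) - 1) * m)"
    and "q1 < q" and "q < q2"
  shows "(m > 0 \<longrightarrow>
      (\<exists>u. P0_minimizer \<alpha> q N M \<Omega> u) \<and>
      (\<forall>u. P0_minimizer \<alpha> q N M \<Omega> u \<longrightarrow>
        (\<exists>U r A B a b. U \<in> sets lebesgue \<and> U \<subseteq> \<Omega> \<and>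
           r = measure lebesgue U / measure lebesgue \<Omega> \<and>
           2 * q\<^sup>2 * r ^ 3 + (2 * q * n - q\<^sup>2) * r\<^sup>2 - \<alpha> * m\<^sup>2 = 0 \<and>
           A = n + (r - 1) * q \<and> B = m / r \<and>
           a = (sqrt ((A + B) / 2), 0, sqrt ((A - B) / 2)) \<and>
           b = (0, root 4 (A\<^sup>2 + \<alpha> * B\<^sup>2), 0) \<and>
           (AE x in lebesgue_on \<Omega>.
              u x = indicator U x *\<^sub>R a + indicator (\<Omega> - U) x *\<^sub>R b)))) \<and>
    (m = 0 \<longrightarrow>
      P0_minimizer \<alpha> q N M \<Omega> (\<lambda>x. indicator \<Omega> x *\<^sub>R (0, sqrt n, 0)) \<and>
      (\<forall>u. P0_minimizer \<alpha> q N M \<Omega> u \<longrightarrow>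
        (AE x in lebesgue_on \<Omega>. u x = indicator \<Omega> x *\<^sub>R (0, sqrt n, 0))))"
proof -
  define W where "W = measure lebesgue \<Omega>"
  have dom: "open \<Omega>" "\<Omega> \<noteq> {}" "bounded \<Omega>"
    using assms(1) by (auto simp: bounded_smooth_domain_def)
  then have \<Omega>: "\<Omega> \<in> lmeasurable" by (simp add: lmeasurable_open)
  have W: "0 < W"
    using open_not_negligible[OF dom(1,2)] \<Omega>
    by (simp add: W_def negligible_iff_measure zero_less_measure_iff less_le)
  have n: "0 < n" and Wn: "W * n = N" and Wm: "W * m = M"
    using assms W by (auto simp: W_def)
  have "sqrt (n\<^sup>2) \<le> sqrt (n\<^sup>2 + \<alpha> * m\<^sup>2)"
    using \<open>0 < \<alpha>\<close> by (intro real_sqrt_le_mono) simp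
  then have q: "0 < q" using assms(10,12) n by simp
  show ?thesis
  proof (rule conjI; rule impI)
    assume m: "m > 0"
    obtain r where r: "0 < r" "r < 1"
      and cubic: "2 * q\<^sup>2 * r ^ 3 + (2 * q * n - q\<^sup>2) * r\<^sup>2 - \<alpha> * m\<^sup>2 = 0"
      and le: "m / r \<le> n + (r - 1) * q"
      using cubic_root[OF \<open>0 < \<alpha>\<close> m n] assms(10-13) by metis
    define A B where "A = n + (r - 1) * q" and "B = m / r"
    have B: "0 < B" "B \<le> A" using m r le by (auto simp: A_def B_def)
    \<comment> \<open>The cubic rewritten with \<open>A\<close>; dividing by
      \<open>r\<^sup>2\<close> gives the relation between the multipliers.\<close>
    have "\<alpha> * m\<^sup>2 = (2 * A * q + q\<^sup>2) * r\<^sup>2"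
      using cubic by (simp add: A_def power2_eq_square power3_eq_cube algebra_simps)
    then have rel: "\<alpha> * B\<^sup>2 = 2 * A * q + q\<^sup>2"
      using r by (simp add: B_def power_divide)
    have "W * (A + (1 - r) * q) = N" "W * (r * B) = M"
      using r Wn Wm by (auto simp: A_def B_def algebra_simps)
    \<comment> \<open>The root \<open>r\<close> is fixed before any minimizer is considered, so one
      value serves as volume fraction for all of them.\<close>
    note min = two_phase_minimizers[OF \<Omega> W[unfolded W_def] \<open>0 < \<alpha>\<close> q B rel r this[unfolded W_def]]
    show "(\<exists>u. P0_minimizer \<alpha> q N M \<Omega> u) \<and>
      (\<forall>u. P0_minimizer \<alpha> q N M \<Omega> u \<longrightarrow>
        (\<exists>U r A B a b. U \<in> sets lebesgue \<and> U \<subseteq> \<Omega> \<and>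
           r = measure lebesgue U / measure lebesgue \<Omega> \<and>
           2 * q\<^sup>2 * r ^ 3 + (2 * q * n - q\<^sup>2) * r\<^sup>2 - \<alpha> * m\<^sup>2 = 0 \<and>
           A = n + (r - 1) * q \<and> B = m / r \<and>
           a = (sqrt ((A + B) / 2), 0, sqrt ((A - B) / 2)) \<and>
           b = (0, root 4 (A\<^sup>2 + \<alpha> * B\<^sup>2), 0) \<and>
           (AE x in lebesgue_on \<Omega>.
              u x = indicator U x *\<^sub>R a + indicator (\<Omega> - U) x *\<^sub>R b)))"
    proof (intro conjI allI impI)
      fix u assume "P0_minimizer \<alpha> q N M \<Omega> u"
      from min(2)[OF this] obtain U where U: "U \<in> sets lebesgue \<and> U \<subseteq> \<Omega> \<and>
          r = measure lebesgue U / measure lebesgue \<Omega> \<and>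
          (AE x in lebesgue_on \<Omega>. u x = indicator U x *\<^sub>R (sqrt ((A + B) / 2), 0, sqrt ((A - B) / 2))
             + indicator (\<Omega> - U) x *\<^sub>R (0, root 4 (A\<^sup>2 + \<alpha> * B\<^sup>2), 0))" ..
      show "\<exists>U r A B a b. U \<in> sets lebesgue \<and> U \<subseteq> \<Omega> \<and>
           r = measure lebesgue U / measure lebesgue \<Omega> \<and>
           2 * q\<^sup>2 * r ^ 3 + (2 * q * n - q\<^sup>2) * r\<^sup>2 - \<alpha> * m\<^sup>2 = 0 \<and>
           A = n + (r - 1) * q \<and> B = m / r \<and>
           a = (sqrt ((A + B) / 2), 0, sqrt ((A - B) / 2)) \<and>
           b = (0, root 4 (A\<^sup>2 + \<alpha> * B\<^sup>2), 0) \<and>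
           (AE x in lebesgue_on \<Omega>.
              u x = indicator U x *\<^sub>R a + indicator (\<Omega> - U) x *\<^sub>R b)"
        by (rule exI[of _ U], rule exI[of _ r], rule exI[of _ A], rule exI[of _ B], intro exI)
          (use U cubic in \<open>intro conjI refl; (simp only: A_def B_def)?; blast\<close>)
    qed (rule min(1))
  next
    assume "m = 0"
    then have "M = 0" using Wm by simp
    then show "P0_minimizer \<alpha> q N M \<Omega> (\<lambda>x. indicator \<Omega> x *\<^sub>R (0, sqrt n, 0)) \<and>
      (\<forall>u. P0_minimizer \<alpha> q N M \<Omega> u \<longrightarrow>
        (AE x in lebesgue_on \<Omega>. u x = indicator \<Omega> x *\<^sub>R (0, sqrt n, 0)))"
      using unmagnetized_minimizers[OF \<Omega> \<open>0 < \<alpha>\<close> q n Wn[unfolded W_def]] by blast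
  qed
qed

end
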